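(* Problem (R2) is equivalent to finding the optimal separated solution of (R1), in the following sense. Assign to every feasible solution $(U,(\lambda^j)_{j\in[k]})$ of (R1) that satisfies the separation condition $$\lambda^j_{v(s)}\big(\lambda^{j'}_{v(s)}\big)^\top=0\qquad\forall s\in[q],\ \forall j\ne j'\in[k]\qquad (\mathrm{S})$$ the vectors $$\lambda_*=\sum_{j\in[k]}\lambda^j,\qquad \lambda_i=\sum_{j\in[k]}u_{ij}\lambda^j\quad(i\in[n]).$$ This induces a bijection, preserving objective values, between the feasible solutions of (R1) satisfying (S), taken modulo simultaneous permutation of the indices $j\in[k]$ in $U$ (columns) and in $(\lambda^j)_{j\in[k]}$, and the feasible solutions $(\lambda_*,\lambda_1,\dots,\lambda_n)$ of (R2). In particular, (R2) and (R1) with the additional constraint (S) have the same optimal value and corresponding optimal solutions. Moreover, if the triangulation $\mathcal{P}=\bigcup_{s\in[q]}P_s$ is separating for problem (C), then (R1) and (R2) are equivalent: they have the same optimal value, and every optimal solution of (R2) corresponds under this bijection to an optimal solution of (R1).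
   Context: Notation: $[n]=\{1,\dots,n\}$; $e$ is the all-ones vector of appropriate dimension; $I_r$ and $J_r$ are the $r\times r$ identity and all-ones matrices; $\langle\cdot,\cdot\rangle$ is the standard inner product; vector inequalities are coordinatewise; $\Delta^m=\{\lambda\in\mathbb{R}^m:\lambda\ge 0,\ \langle\lambda,e\rangle=1\}$ and $k\cdot\Delta^m=\{\lambda\in\mathbb{R}^m:\lambda\ge0,\ \langle\lambda,e\rangle=k\}$. Problem (C): given positive integers $n,k,d,l$ and data $A_i\in\mathbb{R}^{l\times d}$, $b_i\in\mathbb{R}^l$ ($i\in[n]$), minimize $\sum_{i\in[n]}\sum_{j\in[k]}u_{ij}\|A_ix_j-b_i\|_2^2$ over $x_1,\dots,x_k\in\mathbb{R}^d$ and $U=(u_{ij})\in\{0,1\}^{n\times k}$ with $Ue=e$. The points $x_1,\dots,x_k$ are an optimal set of centroids if together with some such $U$ they form an optimal solution. Triangulation: $\mathcal{P}=\bigcup_{s\in[q]}P_s\subseteq\mathbb{R}^d$, where $P_1,\dots,P_q$ are $d$-dimensional simplices with pairwise disjoint interiors; it is assumed that $\{x_j\}_{j\in[k]}\subseteq\mathcal{P}$ is a valid constraint for (C), i.e. an optimal set of centroids is contained in $\mathcal{P}$. Let $V_s\in\mathbb{R}^{d\times(d+1)}$ be the matrix whose columns are the vertices of $P_s$, $m=q(d+1)$, and $V=(V_1,\dots,V_q)\in\mathbb{R}^{d\times m}$ (columns may repeat for different $s$). The coordinates of $\lambda\in\mathbb{R}^m$ are correspondingly split into $q$ consecutive blocks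 $\lambda_{v(1)},\dots,\lambda_{v(q)}\in\mathbb{R}^{d+1}$, so $V\lambda=\sum_{s}V_s\lambda_{v(s)}$. Let $\Omega=(J_q-I_q)\otimes J_{d+1}\in\{0,1\}^{m\times m}$ and $\Delta^m_\Omega=\{\lambda\in\Delta^m:\lambda^\top\Omega\lambda=0\}$. For $i\in[n]$ let $W_i=V^\top A_i^\top A_iV-(e\,b_i^\top A_iV+V^\top A_i^\top b_i\,e^\top)+\|b_i\|_2^2J_m$ (so $\langle\lambda,W_i\lambda\rangle=\|A_iV\lambda-b_i\|_2^2$ for $\lambda\in\Delta^m$). Problem (R1): minimize $\sum_{i\in[n]}\sum_{j\in[k]}u_{ij}\langle\lambda^j,W_i\lambda^j\rangle$ over $U=(u_{ij})\in\{0,1\}^{n\times k}$ with $Ue=e$ and $\lambda^1,\dots,\lambda^k\in\Delta^m_\Omega$. Problem (R2): minimize $\sum_{i\in[n]}\langle\lambda_i,W_i\lambda_i\rangle$ over $\lambda_*,\lambda_1,\dots,\lambda_n\in\mathbb{R}^m$ subject to $\lambda_*\in k\cdot\Delta^m$; $\langle(\lambda_* )_{v(s)},e\rangle(\lambda_* )_{v(s)}=(\lambda_* )_{v(s)}$ for all $s\in[q]$; and $\lambda_i\in\Delta^m_\Omega$, $\lambda_i\le\lambda_*$ for all $i\in[n]$. Separation: a set of $k$ (pairwise distinct) points $\{x_j\}_{j\in[k]}\subseteq\mathcal{P}$ is separated by $\mathcal{P}$ if $|\{x_j\}_{j\in[k]}\cap P_s|\le1$ for all $s\in[q]$. The triangulation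 $\mathcal{P}$ is separating (for (C)) if an optimal set of centroids for (C) is separated by $\mathcal{P}$. *)

theory Defs
  imports "HOL-Analysis.Analysis"
begin

text \<open>
  Sizes are cardinalities of finite index types: \<open>'n\<close> data terms, \<open>'k\<close> centroids, \<open>'q\<close> simplices,
  vectors in \<open>real ^ 'd\<close> and \<open>real ^ 'l\<close>, and \<open>'v\<close> for the vertices of one simplex
  (the theorem assumes \<open>CARD('v) = CARD('d) + 1\<close>).  The coordinates of the lifted space of dimension
  \<open>m = q (d + 1)\<close> are indexed by \<open>'q \<times> 'v\<close>, and block \<open>s\<close> consists of the coordinates \<open>(s, t)\<close>.
  The all-ones vector is \<open>1\<close>.
\<close>

definition ones_mat :: "real ^ 'a ^ 'b" where
  "ones_mat = (\<chi> i j. 1)"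

definition outer :: "real ^ 'a \<Rightarrow> real ^ 'b \<Rightarrow> real ^ 'b ^ 'a" where
  "outer x y = (columnvector x :: real ^ 1 ^ 'a) ** (rowvector y :: real ^ 'b ^ 1)"

definition kronecker ::
  "real ^ 'b ^ 'a \<Rightarrow> real ^ 'd ^ 'c \<Rightarrow> real ^ ('b::finite \<times> 'd::finite) ^ ('a::finite \<times> 'c::finite)" where
  "kronecker M N = (\<chi> r c. M $ fst r $ fst c * N $ snd r $ snd c)"

definition block :: "'q \<Rightarrow> real ^ ('q::finite \<times> 'v::finite) \<Rightarrow> real ^ 'v" where
  "block s y = (\<chi> t. y $ (s, t))"

definition hconcat :: "('q \<Rightarrow> real ^ 'v ^ 'd) \<Rightarrow> real ^ ('q::finite \<times> 'v::finite) ^ 'd" where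
  "hconcat V = (\<chi> r c. V (fst c) $ r $ snd c)"

definition scaled_simplex :: "real \<Rightarrow> (real ^ 'm) set" where
  "scaled_simplex \<kappa> = {y. 0 \<le> y \<and> y \<bullet> 1 = \<kappa>}"

definition Omega :: "real ^ ('q::finite \<times> 'v::finite) ^ ('q \<times> 'v)" where
  "Omega = kronecker (ones_mat - mat 1 :: real ^ 'q ^ 'q) (ones_mat :: real ^ 'v ^ 'v)"

definition simplex_Omega :: "(real ^ ('q::finite \<times> 'v::finite)) set" where
  "simplex_Omega = {y \<in> scaled_simplex 1. y \<bullet> (Omega *v y) = 0}"

definition assignments :: "(real ^ 'k ^ 'n) set" where
  "assignments = {U. (\<forall>i j. U $ i $ j \<in> {0, 1}) \<and> U *v 1 = 1}"

definition optimal_value :: "('a \<Rightarrow> real) \<Rightarrow> 'a set \<Rightarrow> ereal" where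
  "optimal_value f S = (INF x\<in>S. ereal (f x))"

definition optimal_in :: "('a \<Rightarrow> real) \<Rightarrow> 'a set \<Rightarrow> 'a \<Rightarrow> bool" where
  "optimal_in f S x \<longleftrightarrow> is_arg_min f (\<lambda>y. y \<in> S) x"

definition C_feasible :: "((real ^ 'k ^ 'n) \<times> ('k \<Rightarrow> real ^ 'd)) set" where
  "C_feasible = assignments \<times> UNIV"

definition C_obj ::
  "('n::finite \<Rightarrow> real ^ 'd ^ 'l) \<Rightarrow> ('n \<Rightarrow> real ^ 'l) \<Rightarrow> (real ^ 'k ^ 'n) \<times> ('k \<Rightarrow> real ^ 'd) \<Rightarrow> real" where
  "C_obj A b = (\<lambda>(U, x). \<Sum>i\<in>UNIV. \<Sum>j\<in>UNIV. U $ i $ j * (norm (A i *v x j - b i))\<^sup>2)"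

definition optimal_centroids ::
  "('n::finite \<Rightarrow> real ^ 'd ^ 'l) \<Rightarrow> ('n \<Rightarrow> real ^ 'l) \<Rightarrow> ('k::finite \<Rightarrow> real ^ 'd) \<Rightarrow> bool" where
  "optimal_centroids A b x \<longleftrightarrow> (\<exists>U. optimal_in (C_obj A b) C_feasible (U, x))"

definition separated_by :: "('q \<Rightarrow> (real ^ 'd) set) \<Rightarrow> ('k::finite \<Rightarrow> real ^ 'd) \<Rightarrow> bool" where
  "separated_by P x \<longleftrightarrow>
     inj x \<and> range x \<subseteq> (\<Union>s. P s) \<and> (\<forall>s. card (range x \<inter> P s) \<le> 1)"

definition Wmat ::
  "('q \<Rightarrow> real ^ 'v ^ 'd) \<Rightarrow> real ^ 'd ^ 'l \<Rightarrow> real ^ 'l \<Rightarrow> real ^ ('q::finite \<times> 'v::finite) ^ ('q \<times> 'v)" where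
  "Wmat V A b =
     (let VV = hconcat V in
        transpose VV ** transpose A ** A ** VV
        - (outer 1 b ** A ** VV + transpose VV ** transpose A ** outer b 1)
        + (norm b)\<^sup>2 *\<^sub>R ones_mat)"

definition R1_feasible :: "((real ^ 'k ^ 'n) \<times> ('k \<Rightarrow> real ^ ('q::finite \<times> 'v::finite))) set" where
  "R1_feasible = {(U, L). U \<in> assignments \<and> (\<forall>j. L j \<in> simplex_Omega)}"

definition R1_obj ::
  "('q \<Rightarrow> real ^ 'v ^ 'd) \<Rightarrow> ('n::finite \<Rightarrow> real ^ 'd ^ 'l) \<Rightarrow> ('n \<Rightarrow> real ^ 'l)
     \<Rightarrow> (real ^ 'k ^ 'n) \<times> ('k \<Rightarrow> real ^ ('q::finite \<times> 'v::finite)) \<Rightarrow> real" where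
  "R1_obj V A b = (\<lambda>(U, L).
     \<Sum>i\<in>UNIV. \<Sum>j\<in>UNIV. U $ i $ j * (L j \<bullet> (Wmat V (A i) (b i) *v L j)))"

definition sep_condition :: "('k \<Rightarrow> real ^ ('q::finite \<times> 'v::finite)) \<Rightarrow> bool" where
  "sep_condition L \<longleftrightarrow>
     (\<forall>s j j'. j \<noteq> j' \<longrightarrow> outer (block s (L j)) (block s (L j')) = 0)"

definition R1_sep_feasible :: "((real ^ 'k ^ 'n) \<times> ('k \<Rightarrow> real ^ ('q::finite \<times> 'v::finite))) set" where
  "R1_sep_feasible = {(U, L). (U, L) \<in> R1_feasible \<and> sep_condition L}"

text \<open>
  The number \<open>k\<close> does not occur in the type of a feasible point of the second problem, so it is
  passed as an explicit argument.
\<close>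

definition R2_feasible ::
  "nat \<Rightarrow> ((real ^ ('q::finite \<times> 'v::finite)) \<times> ('n \<Rightarrow> real ^ ('q \<times> 'v))) set" where
  "R2_feasible k = {(l0, l).
     l0 \<in> scaled_simplex (real k) \<and>
     (\<forall>s. (block s l0 \<bullet> 1) *\<^sub>R block s l0 = block s l0) \<and>
     (\<forall>i. l i \<in> simplex_Omega \<and> l i \<le> l0)}"

definition R2_obj ::
  "('q \<Rightarrow> real ^ 'v ^ 'd) \<Rightarrow> ('n::finite \<Rightarrow> real ^ 'd ^ 'l) \<Rightarrow> ('n \<Rightarrow> real ^ 'l)
     \<Rightarrow> (real ^ ('q::finite \<times> 'v::finite)) \<times> ('n \<Rightarrow> real ^ ('q \<times> 'v)) \<Rightarrow> real" where
  "R2_obj V A b = (\<lambda>(l0, l). \<Sum>i\<in>UNIV. l i \<bullet> (Wmat V (A i) (b i) *v l i))"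

definition perm_rel ::
  "(((real ^ 'k ^ 'n) \<times> ('k \<Rightarrow> real ^ ('q::finite \<times> 'v::finite))) \<times>
    ((real ^ 'k ^ 'n) \<times> ('k \<Rightarrow> real ^ ('q \<times> 'v)))) set" where
  "perm_rel = {((U, L), (U', L')).
     (U, L) \<in> R1_sep_feasible \<and> (U', L') \<in> R1_sep_feasible \<and>
     (\<exists>\<pi>. \<pi> permutes UNIV \<and> (\<forall>i j. U' $ i $ j = U $ i $ \<pi> j) \<and> (\<forall>j. L' j = L (\<pi> j)))}"

definition to_R2 ::
  "(real ^ 'k ^ 'n) \<times> ('k \<Rightarrow> real ^ ('q::finite \<times> 'v::finite))
     \<Rightarrow> (real ^ ('q \<times> 'v)) \<times> ('n \<Rightarrow> real ^ ('q \<times> 'v))" where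
  "to_R2 = (\<lambda>(U, L). (\<Sum>j\<in>UNIV. L j, \<lambda>i. \<Sum>j\<in>UNIV. U $ i $ j *\<^sub>R L j))"

text \<open>
  The map induced by \<open>to_R2\<close> on equivalence classes; \<open>the_elem\<close> is meaningful because \<open>to_R2\<close> is
  constant on each class of \<open>perm_rel\<close>.
\<close>

definition to_R2_class ::
  "((real ^ 'k ^ 'n) \<times> ('k \<Rightarrow> real ^ ('q::finite \<times> 'v::finite))) set
     \<Rightarrow> (real ^ ('q \<times> 'v)) \<times> ('n \<Rightarrow> real ^ ('q \<times> 'v))" where
  "to_R2_class c = the_elem (to_R2 ` c)"

end

theory Submission
  imports Defs
begin

text \<open>
  A point of \<open>simplex_Omega\<close> is a nonnegative vector with coordinate sum \<open>1\<close> living in a single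
  block, because \<open>\<lambda>\<^sup>T \<Omega> \<lambda>\<close> is the sum of all products of coordinates from different blocks.  It is
  thus a pair of a block index \<open>s\<close> and a point \<open>w\<close> of the small simplex (\<open>simplex_Omega_iff\<close>).  In
  these coordinates condition (S) says that the \<open>k\<close> points use distinct blocks
  (\<open>sep_condition_iff\<close>), so \<open>\<lambda>\<^sub>*\<close> is the \<open>k\<close> points written side by side, and they can be read
  off again from the nonzero blocks of \<open>\<lambda>\<^sub>*\<close>.

  The image under \<open>to_R2\<close> forgets only the labels: two separated solutions with the same image have
  the same set of nonzero blocks, and matching these blocks gives the permutation
  (\<open>to_R2_eq_imp_perm\<close>).  Conversely, the quadratic constraint on \<open>\<lambda>\<^sub>*\<close> forces every nonzero block
  to have sum \<open>1\<close>, so there are exactly \<open>k\<close> of them; a feasible \<open>\<lambda>\<^sub>i\<close> has all its mass \<open>1\<close> in one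
  block, where it lies below a block of \<open>\<lambda>\<^sub>*\<close> of the same mass, and so equals that block
  (\<open>to_R2_surj\<close>).  Objective values agree because \<open>\<lambda>\<^sub>i\<close> is the point to which \<open>i\<close> is assigned.

  For the last part, the identity \<open>\<langle>\<lambda>, W\<lambda>\<rangle> = \<parallel>AV\<lambda> - b\<parallel>\<^sup>2\<close> makes \<open>\<lambda>\<^sup>j \<mapsto> V\<lambda>\<^sup>j\<close> a value-preserving
  map from (R1) to (C), so (C) bounds (R1) from below.  If an optimal set of centroids is separated, its
  barycentric coordinates form a solution of (R1) satisfying (S) that attains this bound.
\<close>

section \<open>Points supported on one block\<close>

definition embed_block :: "'q \<Rightarrow> real ^ 'v \<Rightarrow> real ^ ('q::finite \<times> 'v::finite)" where
  "embed_block s w = (\<chi> p. if fst p = s then w $ snd p else 0)"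

lemma block_embed_block: "block t (embed_block s w) = (if t = s then w else 0)"
  by (simp add: block_def embed_block_def vec_eq_iff)

lemma block_sum: "block s (\<Sum>j\<in>X. f j) = (\<Sum>j\<in>X. block s (f j))"
  by (simp add: block_def vec_eq_iff)

lemma block_mono: "x \<le> y \<Longrightarrow> block s x \<le> block s y"
  by (simp add: block_def less_eq_vec_def)

lemma vec_eq_iff_block: "x = y \<longleftrightarrow> (\<forall>s. block s x = block s y)"
  by (auto simp: block_def vec_eq_iff)

lemma nonneg_nth: "0 \<le> x \<Longrightarrow> 0 \<le> x $ i" for x :: "real ^ 'a"
  by (metis less_eq_vec_def zero_index)

lemma inner_one_vec: "x \<bullet> (1 :: real ^ 'a) = (\<Sum>i\<in>UNIV. x $ i)"
  by (simp add: inner_vec_def)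

lemma sum_UNIV_prod:
  "(\<Sum>p\<in>(UNIV :: ('a::finite \<times> 'b::finite) set). f p) = (\<Sum>s\<in>UNIV. \<Sum>t\<in>UNIV. f (s, t))"
  by (simp add: sum.cartesian_product flip: UNIV_Times_UNIV)

lemma inner_one_eq_sum_blocks: "y \<bullet> 1 = (\<Sum>s\<in>UNIV. block s y \<bullet> 1)"
  by (simp add: inner_one_vec sum_UNIV_prod block_def)

lemma inner_one_embed_block [simp]: "embed_block s w \<bullet> 1 = w \<bullet> 1"
proof -
  have "embed_block s w \<bullet> 1 = (\<Sum>t\<in>UNIV. if t = s then w \<bullet> 1 else 0)"
    unfolding inner_one_eq_sum_blocks[of "embed_block s w"] block_embed_block
    by (intro sum.cong) auto
  then show ?thesis by simp
qed

lemma hconcat_mult_embed_block: "hconcat V *v embed_block s w = V s *v w"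
proof -
  have "(\<Sum>t\<in>UNIV. \<Sum>r\<in>UNIV. V t $ i $ r * (if t = s then w $ r else 0))
      = (\<Sum>t\<in>UNIV. if t = s then \<Sum>r\<in>UNIV. V s $ i $ r * w $ r else 0)" for i
    by (intro sum.cong) auto
  then show ?thesis
    by (simp add: vec_eq_iff matrix_vector_mult_def hconcat_def embed_block_def sum_UNIV_prod cong: if_cong)
qed

lemma scaled_simplex_1_nonzero: "w \<in> scaled_simplex 1 \<Longrightarrow> w \<noteq> 0"
  by (auto simp: scaled_simplex_def)

lemma embed_block_eq_iff:
  assumes "w \<in> scaled_simplex 1" "w' \<in> scaled_simplex 1"
  shows "embed_block s w = embed_block s' w' \<longleftrightarrow> s = s' \<and> w = w'"
  using assms scaled_simplex_1_nonzero
  by (metis block_embed_block)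

lemma inner_Omega:
  "y \<bullet> (Omega *v y) = (\<Sum>p\<in>UNIV. \<Sum>r\<in>UNIV. if fst p = fst r then 0 else y $ p * y $ r)"
  unfolding inner_vec_def matrix_vector_mult_def Omega_def kronecker_def ones_mat_def mat_def
  by (auto intro!: sum.cong simp: sum_distrib_left)

text \<open>
  All products in \<open>\<lambda>\<^sup>T \<Omega> \<lambda>\<close> are nonnegative, so each vanishes; a nonzero coordinate, which exists
  because the coordinates sum to \<open>1\<close>, thus forces every other block to be zero.
\<close>

lemma simplex_Omega_iff:
  "y \<in> simplex_Omega \<longleftrightarrow> (\<exists>s w. w \<in> scaled_simplex 1 \<and> y = embed_block s w)"
proof
  assume "y \<in> simplex_Omega"
  then have nonneg: "0 \<le> y" and one: "y \<bullet> 1 = 1" and zero: "y \<bullet> (Omega *v y) = 0"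
    by (auto simp: simplex_Omega_def scaled_simplex_def)
  have y_nonneg: "0 \<le> y $ p" for p
    using nonneg by (rule nonneg_nth)
  have prod_zero: "y $ p * y $ r = 0" if "fst p \<noteq> fst r" for p r
  proof -
    let ?g = "\<lambda>p r. if fst p = fst r then 0 else y $ p * y $ r"
    have g_nonneg: "0 \<le> ?g p r" for p r
      by (simp add: y_nonneg)
    have "(\<Sum>p\<in>UNIV. \<Sum>r\<in>UNIV. ?g p r) = 0"
      using zero by (simp only: inner_Omega)
    then have "(\<Sum>r\<in>UNIV. ?g p r) = 0"
      using g_nonneg sum_nonneg_eq_0_iff[of UNIV "\<lambda>p. \<Sum>r\<in>UNIV. ?g p r"]
      by (simp add: sum_nonneg del: split_paired_All)
    then have "?g p r = 0"
      using g_nonneg sum_nonneg_eq_0_iff[of UNIV "?g p"] by (simp del: split_paired_All)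
    with that show ?thesis by simp
  qed
  obtain p where p: "y $ p \<noteq> 0"
    using one unfolding inner_one_vec by (metis sum.neutral zero_neq_one)
  have y_eq: "y = embed_block (fst p) (block (fst p) y)"
    unfolding vec_eq_iff
  proof
    fix r
    show "y $ r = embed_block (fst p) (block (fst p) y) $ r"
      using prod_zero[of p r] p by (cases r) (auto simp: embed_block_def block_def)
  qed
  have "block (fst p) y \<in> scaled_simplex 1"
    using y_nonneg one inner_one_embed_block[of "fst p" "block (fst p) y"]
    by (simp add: scaled_simplex_def less_eq_vec_def block_def flip: y_eq[unfolded block_def])
  with y_eq show "\<exists>s w. w \<in> scaled_simplex 1 \<and> y = embed_block s w" by blast
next
  assume "\<exists>s w. w \<in> scaled_simplex 1 \<and> y = embed_block s w"
  then obtain s w where w: "w \<in> scaled_simplex 1" and y: "y = embed_block s w" by blast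
  have "y \<bullet> (Omega *v y) = 0"
    unfolding inner_Omega y by (intro sum.neutral ballI) (auto simp: embed_block_def)
  moreover have "y \<in> scaled_simplex 1"
    using w inner_one_embed_block[of s w]
    by (auto simp: y scaled_simplex_def less_eq_vec_def embed_block_def)
  ultimately show "y \<in> simplex_Omega" by (simp add: simplex_Omega_def)
qed

lemma outer_nth: "outer x y $ i $ j = x $ i * y $ j"
  by (simp add: outer_def matrix_matrix_mult_def columnvector_def rowvector_def)

lemma outer_eq_0_iff: "outer x y = 0 \<longleftrightarrow> x = 0 \<or> y = 0"
  by (auto simp: vec_eq_iff outer_nth)

lemma sep_condition_iff:
  assumes "\<And>j. w j \<in> scaled_simplex 1"
  shows "sep_condition (\<lambda>j. embed_block (\<sigma> j) (w j)) \<longleftrightarrow> inj \<sigma>"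
  using assms[THEN scaled_simplex_1_nonzero]
  by (auto simp: sep_condition_def outer_eq_0_iff block_embed_block inj_def)

section \<open>Parametrizing the feasible solutions of (R1)\<close>

definition assignment_matrix :: "('n \<Rightarrow> 'k) \<Rightarrow> real ^ 'k ^ 'n" where
  "assignment_matrix a = (\<chi> i j. if j = a i then 1 else 0)"

lemma assignment_matrix_mult_sum:
  fixes f :: "'k::finite \<Rightarrow> 'a::real_vector"
  shows "(\<Sum>j\<in>UNIV. assignment_matrix a $ i $ j *\<^sub>R f j) = f (a i)"
proof -
  have "(\<Sum>j\<in>UNIV. assignment_matrix a $ i $ j *\<^sub>R f j) = (\<Sum>j\<in>UNIV. if j = a i then f j else 0)"
    by (intro sum.cong) (auto simp: assignment_matrix_def)
  then show ?thesis by simp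
qed

lemma assignments_iff:
  fixes U :: "real ^ 'k::finite ^ 'n::finite"
  shows "U \<in> assignments \<longleftrightarrow> (\<exists>a. U = assignment_matrix a)"
proof
  assume U: "U \<in> assignments"
  have "\<exists>j. \<forall>j'. U $ i $ j' = (if j' = j then 1 else 0)" for i
  proof -
    have bin: "U $ i $ j = 0 \<or> U $ i $ j = 1" for j
      using U by (auto simp: assignments_def)
    have "(\<Sum>j\<in>UNIV. U $ i $ j) = 1"
      using U by (auto simp: assignments_def vec_eq_iff matrix_vector_mult_def)
    moreover have "(\<Sum>j\<in>UNIV. U $ i $ j) = (\<Sum>j\<in>UNIV. if U $ i $ j = 1 then 1 else 0)"
      using bin by (intro sum.cong) auto
    ultimately have "card {j. U $ i $ j = 1} = 1"
      by (simp flip: sum.inter_filter)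
    then obtain j where "{j. U $ i $ j = 1} = {j}"
      by (auto simp: card_1_singleton_iff)
    with bin show ?thesis by (metis (mono_tags, lifting) mem_Collect_eq singleton_iff)
  qed
  then obtain a where "\<forall>i j'. U $ i $ j' = (if j' = a i then 1 else 0)" by metis
  then show "\<exists>a. U = assignment_matrix a"
    by (auto simp: assignment_matrix_def vec_eq_iff)
next
  assume "\<exists>a. U = assignment_matrix a"
  then show "U \<in> assignments"
    by (auto simp: assignments_def vec_eq_iff matrix_vector_mult_def assignment_matrix_def)
qed

text \<open>
  As \<open>a\<close> ranges over all maps, \<open>\<sigma>\<close> over the injective ones and \<open>w\<close> over tuples of points of the
  small simplex, these are exactly the solutions of (R1) satisfying (S).
\<close>

definition block_solution ::
  "('n \<Rightarrow> 'k) \<Rightarrow> ('k \<Rightarrow> 'q) \<Rightarrow> ('k \<Rightarrow> real ^ 'v)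
     \<Rightarrow> (real ^ 'k ^ 'n) \<times> ('k \<Rightarrow> real ^ ('q::finite \<times> 'v::finite))" where
  "block_solution a \<sigma> w = (assignment_matrix a, \<lambda>j. embed_block (\<sigma> j) (w j))"

lemma block_solution_in_R1_sep_feasible:
  assumes "inj \<sigma>" "\<And>j. w j \<in> scaled_simplex 1"
  shows "block_solution a \<sigma> w \<in> R1_sep_feasible"
  using assms sep_condition_iff[of w \<sigma>]
  by (auto simp: R1_sep_feasible_def R1_feasible_def block_solution_def assignments_iff
      simplex_Omega_iff)

lemma R1_sep_feasibleE:
  assumes "z \<in> R1_sep_feasible"
  obtains a \<sigma> w where "z = block_solution a \<sigma> w" "inj \<sigma>" "\<And>j. w j \<in> scaled_simplex 1"
proof -
  obtain U L where z: "z = (U, L)" by fastforce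
  with assms have U: "U \<in> assignments" and L: "\<And>j. L j \<in> simplex_Omega" and S: "sep_condition L"
    by (auto simp: R1_sep_feasible_def R1_feasible_def)
  from U obtain a where a: "U = assignment_matrix a" by (auto simp: assignments_iff)
  from L have "\<forall>j. \<exists>s w. w \<in> scaled_simplex 1 \<and> L j = embed_block s w"
    by (simp add: simplex_Omega_iff)
  then obtain \<sigma> w where w: "\<And>j. w j \<in> scaled_simplex 1" and "\<And>j. L j = embed_block (\<sigma> j) (w j)"
    by metis
  then have L_eq: "L = (\<lambda>j. embed_block (\<sigma> j) (w j))" by blast
  show thesis
    by (rule that[of a \<sigma> w])
      (use z a L_eq w S sep_condition_iff[of w \<sigma>, OF w] in \<open>auto simp: block_solution_def\<close>)
qed

lemma to_R2_block_solution:
  "to_R2 (block_solution a \<sigma> w)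
     = (\<Sum>j\<in>UNIV. embed_block (\<sigma> j) (w j), \<lambda>i. embed_block (\<sigma> (a i)) (w (a i)))"
  by (simp add: to_R2_def block_solution_def assignment_matrix_mult_sum)

lemma block_sum_embed_block:
  fixes \<sigma> :: "'k::finite \<Rightarrow> 'q::finite"
  assumes "inj \<sigma>"
  shows "block (\<sigma> j) (\<Sum>j\<in>UNIV. embed_block (\<sigma> j) (w j)) = w j"
proof -
  have "(\<Sum>j'\<in>UNIV. block (\<sigma> j) (embed_block (\<sigma> j') (w j'))) = (\<Sum>j'\<in>UNIV. if j' = j then w j' else 0)"
    using assms by (intro sum.cong) (auto simp: block_embed_block inj_eq)
  then show ?thesis by (simp add: block_sum)
qed

lemma block_sum_embed_block_outside:
  fixes \<sigma> :: "'k::finite \<Rightarrow> 'q::finite"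
  assumes "s \<notin> range \<sigma>"
  shows "block s (\<Sum>j\<in>UNIV. embed_block (\<sigma> j) (w j)) = 0"
  unfolding block_sum using assms by (intro sum.neutral) (auto simp: block_embed_block)

section \<open>Feasible solutions of (R2) as relabelling classes\<close>

lemma to_R2_in_R2_feasible:
  fixes z :: "(real ^ 'k::finite ^ 'n::finite) \<times> ('k \<Rightarrow> real ^ ('q::finite \<times> 'v::finite))"
  assumes "z \<in> R1_sep_feasible"
  shows "to_R2 z \<in> R2_feasible CARD('k)"
proof -
  obtain a \<sigma> w where z: "z = block_solution a \<sigma> w" and inj: "inj \<sigma>"
    and w: "\<And>j. w j \<in> scaled_simplex 1"
    using R1_sep_feasibleE[OF assms] by blast
  have w1: "w j \<bullet> 1 = 1" for j
    using w by (simp add: scaled_simplex_def)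
  have emb: "embed_block (\<sigma> j) (w j) \<in> simplex_Omega" for j
    using w by (auto simp: simplex_Omega_iff)
  have pos: "0 \<le> embed_block (\<sigma> j) (w j) $ p" for j p
    using emb by (auto simp: simplex_Omega_def scaled_simplex_def intro: nonneg_nth)
  define l0 where "l0 = (\<Sum>j\<in>UNIV. embed_block (\<sigma> j) (w j))"
  have "l0 \<in> scaled_simplex (real CARD('k))"
    by (simp add: scaled_simplex_def l0_def less_eq_vec_def inner_sum_left w1 sum_nonneg pos)
  moreover have "(block s l0 \<bullet> 1) *\<^sub>R block s l0 = block s l0" for s
    using block_sum_embed_block[OF inj, of _ w] block_sum_embed_block_outside[of s \<sigma> w] w1
    by (cases "s \<in> range \<sigma>") (auto simp flip: l0_def)
  moreover have "embed_block (\<sigma> j) (w j) \<le> l0" for j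
    unfolding less_eq_vec_def l0_def
    by (auto simp: pos intro!: member_le_sum)
  ultimately show ?thesis
    using emb by (simp add: z to_R2_block_solution R2_feasible_def l0_def)
qed

text \<open>
  The mass of \<open>\<lambda>\<^sub>*\<close> is \<open>k\<close> and every nonzero block has mass \<open>1\<close>, so there are exactly \<open>k\<close> nonzero
  blocks; any numbering of them serves as the sequence of centroids.
\<close>

lemma to_R2_surj:
  fixes y :: "(real ^ ('q::finite \<times> 'v::finite)) \<times> ('n::finite \<Rightarrow> real ^ ('q \<times> 'v))"
  assumes "y \<in> R2_feasible CARD('k::finite)"
  shows "\<exists>z \<in> (R1_sep_feasible :: ((real ^ 'k ^ 'n) \<times> ('k \<Rightarrow> real ^ ('q \<times> 'v))) set). to_R2 z = y"
proof -
  obtain l0 l where y: "y = (l0, l)" by fastforce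
  with assms have l0: "0 \<le> l0" "l0 \<bullet> 1 = real CARD('k)"
    and quad: "\<And>s. (block s l0 \<bullet> 1) *\<^sub>R block s l0 = block s l0"
    and l: "\<And>i. l i \<in> simplex_Omega" and le: "\<And>i. l i \<le> l0"
    by (auto simp: R2_feasible_def scaled_simplex_def)
  define N where "N = {s. block s l0 \<noteq> 0}"
  have mass: "block s l0 \<bullet> 1 = (if s \<in> N then 1 else 0)" for s
    using quad[of s] scaleR_cancel_right[of "block s l0 \<bullet> 1" "block s l0" 1] by (auto simp: N_def)
  have "real (card N) = real CARD('k)"
    using l0(2) by (simp add: inner_one_eq_sum_blocks[of l0] mass sum.If_cases)
  then have "card (UNIV :: 'k set) = card N" by simp
  then obtain \<sigma> :: "'k \<Rightarrow> 'q" where "bij_betw \<sigma> UNIV N"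
    using finite_same_card_bij[of "UNIV :: 'k set" N] by (auto simp: N_def)
  then have inj: "inj \<sigma>" and ran: "range \<sigma> = N"
    by (auto simp: bij_betw_def)
  define w where "w j = block (\<sigma> j) l0" for j
  have w: "w j \<in> scaled_simplex 1" for j
  proof -
    have "0 \<le> w j" using l0(1) by (simp add: w_def less_eq_vec_def block_def)
    moreover have "w j \<bullet> 1 = 1" using mass[of "\<sigma> j"] ran by (auto simp: w_def)
    ultimately show ?thesis by (simp add: scaled_simplex_def)
  qed
  have "\<exists>j. l i = embed_block (\<sigma> j) (w j)" for i
  proof -
    obtain s v where v: "v \<in> scaled_simplex 1" and li: "l i = embed_block s v"
      using l[of i] by (auto simp: simplex_Omega_iff)
    have v_le: "v $ t \<le> block s l0 $ t" for t
      using block_mono[OF le[of i], of s] by (simp add: li block_embed_block less_eq_vec_def)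
    have v1: "(\<Sum>t\<in>UNIV. v $ t) = 1"
      using v by (simp add: scaled_simplex_def inner_one_vec)
    have "1 \<le> block s l0 \<bullet> 1"
      unfolding inner_one_vec v1[symmetric] by (intro sum_mono v_le)
    then have sN: "s \<in> N" using mass[of s] by (auto split: if_splits)
    then obtain j where j: "s = \<sigma> j" using ran by auto
    \<comment> \<open>\<open>v\<close> lies below the block of \<open>\<lambda>\<^sub>*\<close> and both have mass \<open>1\<close>, which leaves no room between them.\<close>
    have "(\<Sum>t\<in>UNIV. block s l0 $ t - v $ t) = 0"
      using mass[of s] sN v1 by (simp add: inner_one_vec sum_subtractf)
    then have "\<forall>t\<in>UNIV. block s l0 $ t - v $ t = 0"
      by (subst (asm) sum_nonneg_eq_0_iff) (auto simp: v_le)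
    then have "v = w j" by (simp add: vec_eq_iff w_def j)
    with li j show ?thesis by blast
  qed
  then obtain a where a: "\<And>i. l i = embed_block (\<sigma> (a i)) (w (a i))" by metis
  have "block s l0 = block s (\<Sum>j\<in>UNIV. embed_block (\<sigma> j) (w j))" for s
  proof (cases "s \<in> N")
    case True
    then obtain j where "s = \<sigma> j" using ran by blast
    then show ?thesis using block_sum_embed_block[OF inj, of j w] by (simp add: w_def)
  next
    case False
    then show ?thesis using block_sum_embed_block_outside[of s \<sigma> w] ran by (simp add: N_def)
  qed
  then have "l0 = (\<Sum>j\<in>UNIV. embed_block (\<sigma> j) (w j))"
    using vec_eq_iff_block by blast
  then have "to_R2 (block_solution a \<sigma> w) = y"
    using a by (auto simp: to_R2_block_solution y)
  then show ?thesis
    using block_solution_in_R1_sep_feasible[of \<sigma> w a, OF inj w] by blast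
qed

lemma image_to_R2:
  "to_R2 ` (R1_sep_feasible :: ((real ^ 'k ^ 'n::finite) \<times> ('k::finite \<Rightarrow> real ^ ('q::finite \<times> 'v::finite))) set)
     = R2_feasible CARD('k)"
proof
  show "to_R2 ` (R1_sep_feasible :: ((real ^ 'k ^ 'n) \<times> ('k \<Rightarrow> real ^ ('q \<times> 'v))) set)
     \<subseteq> R2_feasible CARD('k)"
    using to_R2_in_R2_feasible by blast
  show "R2_feasible CARD('k)
     \<subseteq> to_R2 ` (R1_sep_feasible :: ((real ^ 'k ^ 'n) \<times> ('k \<Rightarrow> real ^ ('q \<times> 'v))) set)"
  proof
    fix y :: "(real ^ ('q \<times> 'v)) \<times> ('n \<Rightarrow> real ^ ('q \<times> 'v))"
    assume "y \<in> R2_feasible CARD('k)"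
    from to_R2_surj[OF this]
    show "y \<in> to_R2 ` (R1_sep_feasible :: ((real ^ 'k ^ 'n) \<times> ('k \<Rightarrow> real ^ ('q \<times> 'v))) set)"
      by blast
  qed
qed

text \<open>
  Both solutions occupy the same blocks of \<open>\<lambda>\<^sub>*\<close>, and the content of a block determines the centroid
  in it; the permutation sends a label of the second solution to the label by which the first one
  knows the same block.
\<close>

lemma to_R2_eq_imp_perm:
  fixes z z' :: "(real ^ 'k::finite ^ 'n::finite) \<times> ('k \<Rightarrow> real ^ ('q::finite \<times> 'v::finite))"
  assumes z_in: "z \<in> R1_sep_feasible" and z'_in: "z' \<in> R1_sep_feasible" and eq: "to_R2 z = to_R2 z'"
  shows "(z, z') \<in> perm_rel"
proof -
  obtain a \<sigma> w where z: "z = block_solution a \<sigma> w" and inj: "inj \<sigma>"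
    and w: "\<And>j. w j \<in> scaled_simplex 1"
    using R1_sep_feasibleE[OF z_in] by blast
  obtain a' \<sigma>' w' where z': "z' = block_solution a' \<sigma>' w'" and inj': "inj \<sigma>'"
    and w': "\<And>j. w' j \<in> scaled_simplex 1"
    using R1_sep_feasibleE[OF z'_in] by blast
  from eq have star: "(\<Sum>j\<in>UNIV. embed_block (\<sigma> j) (w j)) = (\<Sum>j\<in>UNIV. embed_block (\<sigma>' j) (w' j))"
    and points: "\<And>i. embed_block (\<sigma> (a i)) (w (a i)) = embed_block (\<sigma>' (a' i)) (w' (a' i))"
    by (auto simp: z z' to_R2_block_solution dest: fun_cong)
  have "\<exists>j'. \<sigma> j' = \<sigma>' j" for j
  proof (rule ccontr)
    assume "\<nexists>j'. \<sigma> j' = \<sigma>' j"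
    then have "\<sigma>' j \<notin> range \<sigma>" by auto
    then have "block (\<sigma>' j) (\<Sum>j\<in>UNIV. embed_block (\<sigma>' j) (w' j)) = 0"
      using block_sum_embed_block_outside[of "\<sigma>' j" \<sigma> w] star by simp
    then show False
      using block_sum_embed_block[OF inj', of j w'] scaled_simplex_1_nonzero[OF w'[of j]] by simp
  qed
  then obtain \<pi> where \<pi>: "\<And>j. \<sigma> (\<pi> j) = \<sigma>' j" by metis
  have "inj \<pi>"
    using inj' \<pi> by (metis injD injI)
  then have perm: "\<pi> permutes UNIV"
    by (intro bij_imp_permutes) (auto simp: bij_betw_def finite_UNIV_inj_surj)
  have w_eq: "w (\<pi> j) = w' j" for j
    using block_sum_embed_block[OF inj, of "\<pi> j" w] block_sum_embed_block[OF inj', of j w'] star \<pi>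
    by simp
  have "\<pi> (a' i) = a i" for i
  proof -
    have "\<sigma> (a i) = \<sigma>' (a' i)"
      using points[of i] embed_block_eq_iff[OF w w'] by blast
    then show ?thesis using \<pi> inj by (metis injD)
  qed
  then have "j = a' i \<longleftrightarrow> \<pi> j = a i" for i j
    using \<open>inj \<pi>\<close> by (metis injD)
  then show ?thesis
    using z_in z'_in perm \<pi> w_eq unfolding perm_rel_def z z' block_solution_def
    by (auto simp: assignment_matrix_def intro!: exI[of _ \<pi>])
qed

lemma to_R2_perm:
  assumes "(z, z') \<in> perm_rel"
  shows "to_R2 z = to_R2 z'"
proof -
  obtain U L U' L' where z: "z = (U, L)" and z': "z' = (U', L')" by fastforce
  with assms obtain \<pi> where \<pi>: "\<pi> permutes UNIV" and U': "\<And>i j. U' $ i $ j = U $ i $ \<pi> j"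
    and L': "\<And>j. L' j = L (\<pi> j)"
    by (auto simp: perm_rel_def)
  have "(\<Sum>j\<in>UNIV. L j) = (\<Sum>j\<in>UNIV. L' j)"
    using sum.permute[OF \<pi>, of L] by (simp add: L' o_def)
  moreover have "(\<Sum>j\<in>UNIV. U $ i $ j *\<^sub>R L j) = (\<Sum>j\<in>UNIV. U' $ i $ j *\<^sub>R L' j)" for i
    using sum.permute[OF \<pi>, of "\<lambda>j. U $ i $ j *\<^sub>R L j"] by (simp add: U' L' o_def)
  ultimately show ?thesis by (simp add: to_R2_def z z')
qed

text \<open>
  Once relabelling is known to be the kernel of \<open>to_R2\<close>, both the equivalence properties and the
  bijection from the quotient to the image are instances of general facts about kernels.
\<close>

lemma perm_rel_iff:
  "(z, z') \<in> perm_rel \<longleftrightarrow> z \<in> R1_sep_feasible \<and> z' \<in> R1_sep_feasible \<and> to_R2 z = to_R2 z'"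
proof -
  have "z \<in> R1_sep_feasible \<and> z' \<in> R1_sep_feasible" if "(z, z') \<in> perm_rel"
    using that by (auto simp: perm_rel_def)
  then show ?thesis using to_R2_eq_imp_perm to_R2_perm by blast
qed

lemma equiv_perm_rel: "equiv R1_sep_feasible perm_rel"
  by (intro equivI refl_onI symI transI) (auto simp: perm_rel_iff)

lemma bij_betw_quotient_the_elem:
  assumes r: "equiv S r" and kernel: "\<And>x y. x \<in> S \<Longrightarrow> y \<in> S \<Longrightarrow> (x, y) \<in> r \<longleftrightarrow> f x = f y"
  shows "bij_betw (\<lambda>c. the_elem (f ` c)) (S // r) (f ` S)"
proof -
  have val: "the_elem (f ` (r `` {x})) = f x" if "x \<in> S" for x
  proof -
    have "f ` (r `` {x}) = {f x}"
      using that kernel equiv_class_self[OF r that] equiv_type[OF r] by fastforce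
    then show ?thesis by simp
  qed
  show ?thesis
  proof (rule bij_betw_imageI)
    show "inj_on (\<lambda>c. the_elem (f ` c)) (S // r)"
    proof (rule inj_onI)
      fix c c' assume c: "c \<in> S // r" "c' \<in> S // r" and eq: "the_elem (f ` c) = the_elem (f ` c')"
      from c obtain x y where "x \<in> S" "c = r `` {x}" "y \<in> S" "c' = r `` {y}"
        by (auto elim!: quotientE)
      with eq show "c = c'" using val kernel equiv_class_eq[OF r, of x y] by simp
    qed
    show "(\<lambda>c. the_elem (f ` c)) ` (S // r) = f ` S"
      by (force elim!: quotientE simp: val intro: quotientI)
  qed
qed

lemma bij_betw_to_R2_class:
  "bij_betw to_R2_class
     ((R1_sep_feasible :: ((real ^ 'k ^ 'n::finite) \<times> ('k::finite \<Rightarrow> real ^ ('q::finite \<times> 'v::finite))) set)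
        // perm_rel)
     (R2_feasible CARD('k))"
  unfolding image_to_R2[symmetric] to_R2_class_def[abs_def]
  by (rule bij_betw_quotient_the_elem[OF equiv_perm_rel]) (simp add: perm_rel_iff)

section \<open>Objective values\<close>

lemma optimal_in_iff: "optimal_in f S x \<longleftrightarrow> x \<in> S \<and> (\<forall>y\<in>S. f x \<le> f y)"
  by (auto simp: optimal_in_def is_arg_min_def not_less)

lemma R2_obj_to_R2:
  assumes "z \<in> R1_sep_feasible"
  shows "R2_obj V A b (to_R2 z) = R1_obj V A b z"
proof -
  obtain a \<sigma> w where z: "z = block_solution a \<sigma> w"
    using R1_sep_feasibleE[OF assms] by blast
  have "(\<Sum>j\<in>UNIV. assignment_matrix a $ i $ j * f j) = f (a i)" for i and f :: "_ \<Rightarrow> real"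
    using assignment_matrix_mult_sum[of a i f] by simp
  then show ?thesis
    unfolding z to_R2_block_solution by (simp add: R2_obj_def R1_obj_def block_solution_def)
qed

lemma outer_mult_vec: "outer x y *v z = (y \<bullet> z) *\<^sub>R x"
  by (simp add: vec_eq_iff matrix_vector_mult_def outer_nth inner_vec_def sum_distrib_left
      mult.commute mult.left_commute)

lemma inner_vec_mult_matrix: "x \<bullet> (y v* M) = (M *v x) \<bullet> y" for M :: "real ^ 'a ^ 'b"
  by (metis dot_lmul_matrix inner_commute)

text \<open>
  The matrix expands the square; multiplying the linear terms by \<open>e\<^sup>T \<lambda> = 1\<close> and the constant by its
  square makes every term quadratic in \<open>\<lambda>\<close>.
\<close>

lemma inner_Wmat:
  assumes "y \<bullet> 1 = 1"
  shows "y \<bullet> (Wmat V A b *v y) = (norm (A *v (hconcat V *v y) - b))\<^sup>2"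
proof -
  have ones: "ones_mat *v y = 1"
    using assms by (simp add: vec_eq_iff ones_mat_def matrix_vector_mult_def inner_one_vec)
  let ?g = "A *v (hconcat V *v y)"
  have one: "1 \<bullet> y = 1" using assms by (simp add: inner_commute)
  have "y \<bullet> (Wmat V A b *v y) = ?g \<bullet> ?g - (b \<bullet> ?g + ?g \<bullet> b) + (norm b)\<^sup>2"
    unfolding Wmat_def Let_def
    by (simp add: matrix_vector_mult_add_rdistrib matrix_vector_mult_diff_rdistrib
        scaleR_matrix_vector_assoc[symmetric] matrix_vector_mul_assoc[symmetric] ones outer_mult_vec
        inner_add_right inner_diff_right inner_vec_mult_matrix one assms)
  also have "\<dots> = (norm (?g - b))\<^sup>2"
    by (simp add: power2_norm_eq_inner inner_diff_left inner_diff_right inner_commute)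
  finally show ?thesis .
qed

lemma R1_obj_eq_C_obj:
  assumes "(U, L) \<in> R1_feasible"
  shows "R1_obj V A b (U, L) = C_obj A b (U, \<lambda>j. hconcat V *v L j)"
proof -
  have "L j \<bullet> 1 = 1" for j
    using assms by (auto simp: R1_feasible_def simplex_Omega_def scaled_simplex_def)
  then show ?thesis
    by (simp add: R1_obj_def C_obj_def inner_Wmat)
qed

section \<open>Barycentric coordinates of separated centroids\<close>

lemma convex_scaled_simplex: "convex (scaled_simplex \<kappa>)"
proof (rule convexI)
  fix x y :: "real ^ 'm" and u v :: real
  assume x: "x \<in> scaled_simplex \<kappa>" and y: "y \<in> scaled_simplex \<kappa>"
    and uv: "0 \<le> u" "0 \<le> v" "u + v = 1"
  have "u * \<kappa> + v * \<kappa> = \<kappa>" using uv by (simp flip: distrib_right)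
  then show "u *\<^sub>R x + v *\<^sub>R y \<in> scaled_simplex \<kappa>"
    using x y uv by (auto simp: scaled_simplex_def less_eq_vec_def inner_add_left)
qed

text \<open>
  The right-hand side is convex and contains each column as the image of a unit vector;
  a preimage of a point is a tuple of barycentric coordinates of it.
\<close>

lemma convex_hull_columns_subset:
  fixes M :: "real ^ 'v::finite ^ 'd::finite"
  shows "convex hull (columns M) \<subseteq> (*v) M ` scaled_simplex 1"
proof (rule hull_minimal)
  show "convex ((*v) M ` scaled_simplex 1)"
    by (intro convex_linear_image convex_scaled_simplex) simp
  show "columns M \<subseteq> (*v) M ` scaled_simplex 1"
  proof
    fix x assume "x \<in> columns M"
    then obtain t where "x = column t M" by (auto simp: columns_def)
    then have "x = M *v axis t 1" by (simp add: matrix_vector_mult_basis)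
    moreover have "axis t 1 \<in> (scaled_simplex 1 :: (real ^ 'v) set)"
      by (auto simp: scaled_simplex_def less_eq_vec_def axis_def inner_one_vec)
    ultimately show "x \<in> (*v) M ` scaled_simplex 1" by blast
  qed
qed

lemma simplex_subset_columns_image:
  fixes M :: "real ^ 'v::finite ^ 'd::finite"
  assumes "n simplex S" "columns M = {x. x extreme_point_of S}"
  shows "S \<subseteq> (*v) M ` scaled_simplex 1"
proof -
  have "S = convex hull {x. x extreme_point_of S}"
    using simplex_imp_polytope[OF assms(1)]
    by (intro Krein_Milman_Minkowski polytope_imp_compact polytope_imp_convex)
  then show ?thesis using convex_hull_columns_subset[of M] assms(2) by simp
qed

text \<open>
  Each centroid is given the barycentric coordinates in one simplex containing it.  Distinct centroids
  cannot share a simplex, so they are placed in distinct blocks and (S) holds.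
\<close>

lemma separated_lift:
  fixes V :: "'q::finite \<Rightarrow> real ^ 'v::finite ^ 'd::finite" and x :: "'k::finite \<Rightarrow> real ^ 'd"
  assumes P: "\<And>s. P s \<subseteq> (*v) (V s) ` scaled_simplex 1" and sep: "separated_by P x"
    and U: "U \<in> assignments"
  obtains L where "(U, L) \<in> R1_sep_feasible" "\<And>j. hconcat V *v L j = x j"
proof -
  have "\<exists>s w. x j \<in> P s \<and> w \<in> scaled_simplex 1 \<and> V s *v w = x j" for j
  proof -
    from sep have "x j \<in> (\<Union>s. P s)" by (auto simp: separated_by_def)
    then obtain s where s: "x j \<in> P s" by blast
    then have "x j \<in> (*v) (V s) ` scaled_simplex 1" using P by blast
    with s show ?thesis by force
  qed
  then obtain \<sigma> w where x: "\<And>j. x j \<in> P (\<sigma> j)" and w: "\<And>j. w j \<in> scaled_simplex 1"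
    and V: "\<And>j. V (\<sigma> j) *v w j = x j"
    by metis
  have inj: "inj \<sigma>"
  proof (rule injI)
    fix j j' assume "\<sigma> j = \<sigma> j'"
    then have "x j \<in> range x \<inter> P (\<sigma> j)" "x j' \<in> range x \<inter> P (\<sigma> j)"
      using x by (metis IntI rangeI)+
    moreover have "\<forall>y\<in>range x \<inter> P (\<sigma> j). \<forall>y'\<in>range x \<inter> P (\<sigma> j). y = y'"
      using sep unfolding separated_by_def by (subst card_le_Suc0_iff_eq[symmetric]) auto
    ultimately have "x j = x j'" by blast
    moreover have "inj x" using sep by (simp add: separated_by_def)
    ultimately show "j = j'" by (simp add: inj_eq)
  qed
  obtain a where a: "U = assignment_matrix a" using U by (auto simp: assignments_iff)
  show thesis
  proof (rule that)
    show "(U, \<lambda>j. embed_block (\<sigma> j) (w j)) \<in> R1_sep_feasible"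
      using block_solution_in_R1_sep_feasible[of \<sigma> w a, OF inj w] by (simp add: a block_solution_def)
    show "hconcat V *v embed_block (\<sigma> j) (w j) = x j" for j
      by (simp add: hconcat_mult_embed_block V)
  qed
qed

text \<open>
  The separated lift of an optimal solution of (C) attains the lower bound that (C) imposes on (R1).
\<close>

lemma separating_imp_optimal_R1:
  fixes V :: "'q::finite \<Rightarrow> real ^ 'v::finite ^ 'd::finite" and x :: "'k::finite \<Rightarrow> real ^ 'd"
  assumes P: "\<And>s. P s \<subseteq> (*v) (V s) ` scaled_simplex 1"
    and opt: "optimal_centroids A b x" and sep: "separated_by P x"
  obtains z :: "(real ^ 'k ^ 'n::finite) \<times> ('k \<Rightarrow> real ^ ('q \<times> 'v))"
  where "z \<in> R1_sep_feasible" "optimal_in (R1_obj V A b) R1_feasible z"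
proof -
  obtain U where "optimal_in (C_obj A b) C_feasible (U, x)"
    using opt unfolding optimal_centroids_def by blast
  then have U: "U \<in> assignments"
    and min: "\<And>U' x'. (U' :: real ^ 'k ^ 'n) \<in> assignments \<Longrightarrow> C_obj A b (U, x) \<le> C_obj A b (U', x')"
    by (auto simp: optimal_in_iff C_feasible_def)
  obtain L where L: "(U, L) \<in> R1_sep_feasible" and Vx: "\<And>j. hconcat V *v L j = x j"
    using separated_lift[OF P sep U] by blast
  have feas: "(U, L) \<in> R1_feasible" using L by (simp add: R1_sep_feasible_def)
  have "R1_obj V A b (U, L) \<le> R1_obj V A b (U', L')" if "(U', L') \<in> R1_feasible"
    for U' :: "real ^ 'k ^ 'n" and L' :: "'k \<Rightarrow> real ^ ('q \<times> 'v)"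
  proof -
    have "U' \<in> assignments" using that by (simp add: R1_feasible_def)
    then show ?thesis using min R1_obj_eq_C_obj[OF feas, of V A b] R1_obj_eq_C_obj[OF that, of V A b]
      by (simp add: Vx)
  qed
  then have "optimal_in (R1_obj V A b) R1_feasible (U, L)"
    using feas by (auto simp: optimal_in_iff)
  with L show thesis by (rule that)
qed

section \<open>Equivalence of (R1) and (R2)\<close>

lemma optimal_value_eqI: "optimal_in f S x \<Longrightarrow> optimal_value f S = ereal (f x)"
  unfolding optimal_value_def optimal_in_iff
  by (intro antisym INF_lower INF_greatest) auto

theorem corollary8:
  fixes A :: "'n::finite \<Rightarrow> real ^ 'd::finite ^ 'l::finite"
    and b :: "'n \<Rightarrow> real ^ 'l"
    and P :: "'q::finite \<Rightarrow> (real ^ 'd) set"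
    and V :: "'q \<Rightarrow> real ^ 'v::finite ^ 'd"
  assumes vertex_count: "CARD('v) = CARD('d) + 1"
    and simplices: "\<And>s. int CARD('d) simplex P s"
    and disjoint_interiors: "\<And>s s'. s \<noteq> s' \<Longrightarrow> interior (P s) \<inter> interior (P s') = {}"
    and vertices: "\<And>s. columns (V s) = {x. x extreme_point_of P s}"
    and valid: "\<exists>x :: 'k::finite \<Rightarrow> real ^ 'd. optimal_centroids A b x \<and> range x \<subseteq> (\<Union>s. P s)"
  shows
    "let F1 = (R1_feasible :: ((real ^ 'k ^ 'n) \<times> ('k \<Rightarrow> real ^ ('q \<times> 'v))) set);
         F1S = (R1_sep_feasible :: ((real ^ 'k ^ 'n) \<times> ('k \<Rightarrow> real ^ ('q \<times> 'v))) set);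
         E = (perm_rel :: (((real ^ 'k ^ 'n) \<times> ('k \<Rightarrow> real ^ ('q \<times> 'v))) \<times>
                           ((real ^ 'k ^ 'n) \<times> ('k \<Rightarrow> real ^ ('q \<times> 'v)))) set);
         F2 = (R2_feasible CARD('k) :: ((real ^ ('q \<times> 'v)) \<times> ('n \<Rightarrow> real ^ ('q \<times> 'v))) set);
         f1 = R1_obj V A b;
         f2 = R2_obj V A b
     in equiv F1S E
        \<and> to_R2 respects E
        \<and> bij_betw to_R2_class (F1S // E) F2
        \<and> (\<forall>z\<in>F1S. f2 (to_R2 z) = f1 z)
        \<and> optimal_value f2 F2 = optimal_value f1 F1S
        \<and> (\<forall>z\<in>F1S. optimal_in f1 F1S z \<longleftrightarrow> optimal_in f2 F2 (to_R2 z))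
        \<and> ((\<exists>x :: 'k \<Rightarrow> real ^ 'd. optimal_centroids A b x \<and> separated_by P x) \<longrightarrow>
             optimal_value f1 F1 = optimal_value f2 F2
             \<and> (\<forall>y. optimal_in f2 F2 y \<longrightarrow>
                  (\<exists>c \<in> F1S // E. to_R2_class c = y \<and> (\<forall>z\<in>c. optimal_in f1 F1 z))))"
proof -
  define F1 where "F1 = (R1_feasible :: ((real ^ 'k ^ 'n) \<times> ('k \<Rightarrow> real ^ ('q \<times> 'v))) set)"
  define F1S where "F1S = (R1_sep_feasible :: ((real ^ 'k ^ 'n) \<times> ('k \<Rightarrow> real ^ ('q \<times> 'v))) set)"
  define E where "E = (perm_rel :: (((real ^ 'k ^ 'n) \<times> ('k \<Rightarrow> real ^ ('q \<times> 'v))) \<times>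
                           ((real ^ 'k ^ 'n) \<times> ('k \<Rightarrow> real ^ ('q \<times> 'v)))) set)"
  define F2 where "F2 = (R2_feasible CARD('k) :: ((real ^ ('q \<times> 'v)) \<times> ('n \<Rightarrow> real ^ ('q \<times> 'v))) set)"
  define f1 :: "(real ^ 'k ^ 'n) \<times> ('k \<Rightarrow> real ^ ('q \<times> 'v)) \<Rightarrow> real" where "f1 = R1_obj V A b"
  define f2 where "f2 = R2_obj V A b"
  have sub: "F1S \<subseteq> F1" by (auto simp: F1S_def F1_def R1_sep_feasible_def)
  have equiv: "equiv F1S E" unfolding F1S_def E_def by (rule equiv_perm_rel)
  have resp: "to_R2 respects E"
    unfolding E_def by (rule congruentI) (simp add: perm_rel_iff)
  have bij: "bij_betw to_R2_class (F1S // E) F2"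
    unfolding F1S_def E_def F2_def by (rule bij_betw_to_R2_class)
  have obj: "f2 (to_R2 z) = f1 z" if "z \<in> F1S" for z
    using that R2_obj_to_R2 unfolding F1S_def f1_def f2_def by blast
  have img: "F2 = to_R2 ` F1S" unfolding F1S_def F2_def by (rule image_to_R2[symmetric])
  have val: "optimal_value f2 F2 = optimal_value f1 F1S"
    unfolding optimal_value_def img image_image by (intro INF_cong) (auto simp: obj)
  have opt: "optimal_in f1 F1S z \<longleftrightarrow> optimal_in f2 F2 (to_R2 z)" if "z \<in> F1S" for z
    using that by (auto simp: optimal_in_iff img obj)
  have separating: "optimal_value f1 F1 = optimal_value f2 F2
      \<and> (\<forall>y. optimal_in f2 F2 y \<longrightarrow>
           (\<exists>c \<in> F1S // E. to_R2_class c = y \<and> (\<forall>z\<in>c. optimal_in f1 F1 z)))"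
    if ex: "\<exists>x :: 'k \<Rightarrow> real ^ 'd. optimal_centroids A b x \<and> separated_by P x"
  proof -
    have "P s \<subseteq> (*v) (V s) ` scaled_simplex 1" for s
      using simplex_subset_columns_image simplices vertices by blast
    with ex obtain z0 where z0: "z0 \<in> F1S" and opt0: "optimal_in f1 F1 z0"
      unfolding F1S_def F1_def f1_def by (metis separating_imp_optimal_R1)
    have opt0S: "optimal_in f1 F1S z0"
      using z0 opt0 sub by (auto simp: optimal_in_iff)
    have "optimal_value f1 F1 = optimal_value f2 F2"
      using optimal_value_eqI[OF opt0] optimal_value_eqI[OF opt0S] val by simp
    moreover have "\<exists>c \<in> F1S // E. to_R2_class c = y \<and> (\<forall>z\<in>c. optimal_in f1 F1 z)"
      if y: "optimal_in f2 F2 y" for y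
    proof -
      have "y \<in> F2" using y by (simp add: optimal_in_iff)
      then obtain c where c: "c \<in> F1S // E" and cy: "to_R2_class c = y"
        using bij by (auto simp: bij_betw_def)
      have "optimal_in f1 F1 z" if "z \<in> c" for z
      proof -
        have z: "z \<in> F1S" using that c in_quotient_imp_subset[OF equiv] by blast
        have "to_R2 ` c = {to_R2 z}"
          using that congruentD[OF resp] quotient_eq_iff[OF equiv c c] in_quotient_imp_in_rel[OF equiv c]
          by blast
        then have "to_R2 z = y" using cy by (simp add: to_R2_class_def)
        then have "optimal_in f1 F1S z" using y opt z by simp
        \<comment> \<open>\<open>z\<close> is at least as good as \<open>z0\<close>, which is optimal for (R1) without (S).\<close>
        then show ?thesis
          using z0 opt0 sub z by (auto simp: optimal_in_iff intro: order_trans)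
      qed
      with c cy show ?thesis by blast
    qed
    ultimately show ?thesis by blast
  qed
  show ?thesis
    using equiv resp bij obj val opt separating
    unfolding Let_def F1_def F1S_def E_def F2_def f1_def f2_def by blast
qed

end
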